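(* Let $\Psi\in\mathbb{R}^{n\times p}$ have columns $\psi_1,\dots,\psi_p$ with $\|\psi_i\|=1$ for all $i$, let $y\in\mathbb{R}^n$, let $\lambda>0$, and let $\rho_{\lambda,\tau}$ be any one of the five nonconvex penalties $\ell^0$, bridge, capped-$\ell^1$, SCAD, MCP (with $\tau$ in the admissible range for that penalty). Then the problem $$\min_{x\in\mathbb{R}^p} J(x),\qquad J(x)=\tfrac12\|\Psi x-y\|^2+\sum_{i=1}^p\rho_{\lambda,\tau}(x_i),$$ has at least one global minimizer.
   Context: $\|\cdot\|$ is the Euclidean norm. No assumption is made on the rank of $\Psi$. For $\lambda>0$ the five nonconvex penalties $\rho=\rho_{\lambda,\tau}:\mathbb{R}\to[0,\infty)$ are: (1) $\ell^0$: $\rho(t)=\lambda$ if $t\neq0$, $\rho(0)=0$ (no parameter $\tau$). (2) bridge, $0<\tau<1$: $\rho(t)=\lambda|t|^\tau$. (3) capped-$\ell^1$, $\tau>\frac12$: $\rho(t)=\lambda^2\tau$ if $|t|>\lambda\tau$, and $\rho(t)=\lambda|t|$ if $|t|\le\lambda\tau$. (4) SCAD, $\tau>2$: $\rho(t)=\frac{\lambda^2(\tau+1)}{2}$ if $|t|>\lambda\tau$; $\rho(t)=\frac{\lambda\tau|t|-\frac12(t^2+\lambda^2)}{\tau-1}$ if $\lambda<|t|\le\lambda\tau$; $\rho(t)=\lambda|t|$ if $|t|\le\lambda$. (5) MCP, $\tau>1$: $\rho(t)=\lambda\left(|t|-\frac{t^2}{2\lambda\tau}\right)$ if $|t|<\tau\lambda$,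 and $\rho(t)=\frac{\lambda^2\tau}{2}$ if $|t|\ge\tau\lambda$. *)

theory Defs
  imports "HOL-Analysis.Analysis"
begin

definition l0_penalty :: "real \<Rightarrow> real \<Rightarrow> real" where
  "l0_penalty lam t = (if t \<noteq> 0 then lam else 0)"

text \<open>For \<open>\<tau> > 0\<close> the convention \<open>0 powr \<tau> = 0\<close> gives the intended value at \<open>t = 0\<close>.\<close>

definition bridge_penalty :: "real \<Rightarrow> real \<Rightarrow> real \<Rightarrow> real" where
  "bridge_penalty lam \<tau> t = lam * \<bar>t\<bar> powr \<tau>"

definition capped_l1_penalty :: "real \<Rightarrow> real \<Rightarrow> real \<Rightarrow> real" where
  "capped_l1_penalty lam \<tau> t =
     (if \<bar>t\<bar> > lam * \<tau> then lam\<^sup>2 * \<tau> else lam * \<bar>t\<bar>)"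

definition scad_penalty :: "real \<Rightarrow> real \<Rightarrow> real \<Rightarrow> real" where
  "scad_penalty lam \<tau> t =
     (if \<bar>t\<bar> > lam * \<tau> then lam\<^sup>2 * (\<tau> + 1) / 2
      else if \<bar>t\<bar> > lam then (lam * \<tau> * \<bar>t\<bar> - (t\<^sup>2 + lam\<^sup>2) / 2) / (\<tau> - 1)
      else lam * \<bar>t\<bar>)"

definition mcp_penalty :: "real \<Rightarrow> real \<Rightarrow> real \<Rightarrow> real" where
  "mcp_penalty lam \<tau> t =
     (if \<bar>t\<bar> < \<tau> * lam then lam * (\<bar>t\<bar> - t\<^sup>2 / (2 * lam * \<tau>)) else lam\<^sup>2 * \<tau> / 2)"

text \<open>\<open>nonconvex_penalty lam \<rho>\<close>: for this \<open>lam\<close> and some admissible \<open>\<tau>\<close>, the function \<open>\<rho>\<close> is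
  one of the five penalties. Positivity of \<open>lam\<close> is not included.\<close>

inductive nonconvex_penalty :: "real \<Rightarrow> (real \<Rightarrow> real) \<Rightarrow> bool" for lam :: real where
  l0: "nonconvex_penalty lam (l0_penalty lam)"
| bridge: "0 < \<tau> \<Longrightarrow> \<tau> < 1 \<Longrightarrow> nonconvex_penalty lam (bridge_penalty lam \<tau>)"
| capped_l1: "\<tau> > 1 / 2 \<Longrightarrow> nonconvex_penalty lam (capped_l1_penalty lam \<tau>)"
| scad: "\<tau> > 2 \<Longrightarrow> nonconvex_penalty lam (scad_penalty lam \<tau>)"
| mcp: "\<tau> > 1 \<Longrightarrow> nonconvex_penalty lam (mcp_penalty lam \<tau>)"

definition objective ::
    "real ^ 'p ^ 'n \<Rightarrow> real ^ 'n \<Rightarrow> (real \<Rightarrow> real) \<Rightarrow> real ^ 'p \<Rightarrow> real" where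
  "objective \<Psi> y \<rho> x = 1 / 2 * (norm (\<Psi> *v x - y))\<^sup>2 + (\<Sum>i\<in>UNIV. \<rho> (x $ i))"

end

theory Submission
  imports Defs "HOL-Real_Asymp.Real_Asymp"
begin

text \<open>
  All penalties except the bridge are constant for large arguments, so they do not make \<open>J\<close>
  coercive when \<open>\<Psi>\<close> has a kernel: a minimizing sequence may escape to infinity. Such an escape
  costs nothing, however. Along coordinates where the penalty has already reached its maximum, only
  the least-squares term matters, and a quadratic attains its minimum over an affine subspace
  even without coercivity, because the range of a linear map is closed.

  This is organised around a set \<open>S\<close> of coordinates that are left free and unpenalised, while the
  others are confined to \<open>[-T, T]\<close> and penalised. Minimizing out the free coordinates replaces the
  least-squares term by half the squared distance to a subspace, which is continuous; what remains
  is a lower semicontinuous function on a compact box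
  (\<open>least_squares_box_attains_min\<close>). Lower semicontinuity rather than continuity is
  needed for the \<open>\<ell>\<^sup>0\<close> penalty.

  The bridge penalty is coercive: a large \<open>T\<close> makes every point outside the box no better than \<open>0\<close>, so
  \<open>S = {}\<close> suffices (\<open>objective_attains_min_of_coercive\<close>). The other four saturate: they are at
  most \<open>M\<close>, with equality beyond a threshold \<open>T\<close>. Then \<open>J\<close> is the pointwise minimum, over the
  finitely many \<open>S\<close>, of functions that charge a flat \<open>M\<close> for each coordinate in \<open>S\<close>. At each point
  this minimum is attained by a set \<open>S\<close> off which the coordinates lie in \<open>[-T, T]\<close>, so the best of
  the restricted minimizers is a global one
  (\<open>objective_attains_min_of_saturating\<close>).
\<close>

section \<open>Lower semicontinuous functions\<close>

definition lower_semicontinuous :: "('a::topological_space \<Rightarrow> real) \<Rightarrow> bool" where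
  "lower_semicontinuous f \<longleftrightarrow> (\<forall>c. open {x. c < f x})"

lemma lower_semicontinuous_continuous:
  assumes "continuous_on UNIV f"
  shows "lower_semicontinuous f"
  unfolding lower_semicontinuous_def
  using assms by (auto intro: open_Collect_less continuous_intros)

lemma lower_semicontinuous_compose:
  assumes "lower_semicontinuous f" and "continuous_on UNIV h"
  shows "lower_semicontinuous (\<lambda>x. f (h x))"
  unfolding lower_semicontinuous_def
proof
  fix c
  have "open (h -` {x. c < f x})"
    using assms by (intro open_vimage) (auto simp: lower_semicontinuous_def)
  then show "open {x. c < f (h x)}"
    by (simp add: vimage_def)
qed

lemma lower_semicontinuous_add:
  assumes "lower_semicontinuous f" and "lower_semicontinuous g"
  shows "lower_semicontinuous (\<lambda>x. f x + g x)"
  unfolding lower_semicontinuous_def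
proof
  fix c
  \<comment> \<open>The witness is the midpoint of the interval from \<open>c - g x\<close> to \<open>f x\<close>.\<close>
  have split: "\<exists>a. a < f x \<and> c - a < g x" if "c < f x + g x" for x
    using that by (intro exI[of _ "(f x + (c - g x)) / 2"]) (auto simp: field_simps)
  have "{x. c < f x + g x} = (\<Union>a. {x. a < f x} \<inter> {x. c - a < g x})"
    using split by fastforce
  moreover have "open (\<Union>a. {x. a < f x} \<inter> {x. c - a < g x})"
    using assms by (auto simp: lower_semicontinuous_def)
  ultimately show "open {x. c < f x + g x}"
    by simp
qed

lemma lower_semicontinuous_sum:
  assumes "finite I" and "\<And>i. i \<in> I \<Longrightarrow> lower_semicontinuous (f i)"
  shows "lower_semicontinuous (\<lambda>x. \<Sum>i\<in>I. f i x)"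
  using assms
proof (induction I rule: finite_induct)
  case empty
  then show ?case
    by (simp add: lower_semicontinuous_continuous)
next
  case (insert j I)
  then show ?case
    by (simp add: lower_semicontinuous_add)
qed

text \<open>If no point of \<open>K\<close> were a minimizer, the open sets \<open>{x. f z < f x}\<close> with \<open>z \<in> K\<close> would cover
  \<open>K\<close>. Among the finitely many \<open>z\<close> of a subcover, one with least value lies in none of them.\<close>

lemma lower_semicontinuous_attains_min:
  assumes "lower_semicontinuous f" and "compact K" and "K \<noteq> {}"
  shows "\<exists>x\<in>K. \<forall>z\<in>K. f x \<le> f z"
proof (rule ccontr)
  assume "\<not> ?thesis"
  then have "K \<subseteq> (\<Union>z\<in>K. {x. f z < f x})"
    by (auto simp: not_le)
  then obtain F where F: "F \<subseteq> K" "finite F" "K \<subseteq> (\<Union>z\<in>F. {x. f z < f x})"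
    using compactE_image[OF \<open>compact K\<close>, of K "\<lambda>z. {x. f z < f x}"] assms(1)
    unfolding lower_semicontinuous_def by blast
  then have "F \<noteq> {}"
    using \<open>K \<noteq> {}\<close> by auto
  define m where "m = arg_min_on f F"
  have "m \<in> F" and "\<And>z. z \<in> F \<Longrightarrow> f m \<le> f z"
    unfolding m_def using \<open>finite F\<close> \<open>F \<noteq> {}\<close> by (auto simp: arg_min_if_finite arg_min_least)
  then show False
    using F by (force simp: not_less)
qed

section \<open>Penalised least squares with some coordinates free\<close>

lemma closed_box_on_coordinates:
  "closed {u :: real ^ 'p. (\<forall>i\<in>S. u $ i = 0) \<and> (\<forall>i\<in>-S. \<bar>u $ i\<bar> \<le> T)}"
  unfolding Collect_conj_eq Collect_ball_eq
  by (intro closed_Int closed_INT ballI closed_Collect_eq closed_Collect_le continuous_intros)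

text \<open>Every \<open>z\<close> splits as \<open>w + (z - w)\<close> with \<open>w\<close> supported off \<open>S\<close> and \<open>z - w\<close> supported on \<open>S\<close>. For
  fixed \<open>w\<close> the best choice of the second part attains the distance of \<open>y - \<Psi> w\<close> to the closed
  subspace \<open>R\<close> spanned by the columns in \<open>S\<close>, so only \<open>w\<close>, which ranges over a compact box, remains to
  be optimised. This works for linearly dependent columns, where the second part need not be
  unique and the constraint region is unbounded in directions that \<open>\<Psi>\<close> does not see.\<close>

lemma least_squares_box_attains_min:
  fixes \<Psi> :: "real ^ 'p ^ 'n"
  assumes lsc: "lower_semicontinuous \<rho>" and "0 \<le> T"
  shows "\<exists>x. \<forall>z. (\<forall>i\<in>-S. \<bar>z $ i\<bar> \<le> T) \<longrightarrow>
           1 / 2 * (norm (\<Psi> *v x - y))\<^sup>2 + (\<Sum>i\<in>-S. \<rho> (x $ i))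
         \<le> 1 / 2 * (norm (\<Psi> *v z - y))\<^sup>2 + (\<Sum>i\<in>-S. \<rho> (z $ i))"
proof -
  define V where "V = {v :: real ^ 'p. \<forall>i\<in>-S. v $ i = 0}"
  define R where "R = (\<lambda>v. \<Psi> *v v) ` V"
  define K where "K = {u :: real ^ 'p. (\<forall>i\<in>S. u $ i = 0) \<and> (\<forall>i\<in>-S. \<bar>u $ i\<bar> \<le> T)}"
  define g where "g u = 1 / 2 * (infdist (y - \<Psi> *v u) R)\<^sup>2 + (\<Sum>i\<in>-S. \<rho> (u $ i))" for u
  have "subspace V"
    by (auto simp: V_def subspace_def)
  then have "subspace R"
    unfolding R_def by (intro linear_subspace_image matrix_vector_mul_linear)
  then have "closed R" and "R \<noteq> {}"
    by (auto intro: closed_subspace subspace_0)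
  have "K \<subseteq> cbox (\<chi> i. - T) (\<chi> i. T)"
    using \<open>0 \<le> T\<close> by (auto simp: K_def mem_box_cart abs_le_iff) (smt (verit) ComplI)+
  then have "bounded K"
    using bounded_cbox bounded_subset by blast
  then have "compact K"
    using closed_box_on_coordinates[of S T] by (simp add: K_def compact_eq_bounded_closed)
  have "0 \<in> K"
    using \<open>0 \<le> T\<close> by (simp add: K_def)
  have "lower_semicontinuous g"
    unfolding g_def
    by (intro lower_semicontinuous_add lower_semicontinuous_sum
          lower_semicontinuous_compose[OF lsc] lower_semicontinuous_continuous
          continuous_intros linear_continuous_on
          matrix_vector_mul_bounded_linear) auto
  then obtain u where "u \<in> K" and u: "\<And>w. w \<in> K \<Longrightarrow> g u \<le> g w"
    using lower_semicontinuous_attains_min[OF _ \<open>compact K\<close>] \<open>0 \<in> K\<close> by blast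
  obtain v where "v \<in> V" and v: "infdist (y - \<Psi> *v u) R = dist (y - \<Psi> *v u) (\<Psi> *v v)"
    using infdist_attains_inf[OF \<open>closed R\<close> \<open>R \<noteq> {}\<close>] unfolding R_def by blast
  show ?thesis
  proof (intro exI[of _ "u + v"] allI impI)
    fix z :: "real ^ 'p"
    assume z: "\<forall>i\<in>-S. \<bar>z $ i\<bar> \<le> T"
    define w where "w = (\<chi> i. if i \<in> S then 0 else z $ i)"
    have "w \<in> K" and "z - w \<in> V" and sums: "(\<Sum>i\<in>-S. \<rho> (w $ i)) = (\<Sum>i\<in>-S. \<rho> (z $ i))"
      using z by (auto simp: w_def K_def V_def)
    have "infdist (y - \<Psi> *v w) R \<le> dist (y - \<Psi> *v w) (\<Psi> *v (z - w))"
      using \<open>z - w \<in> V\<close> by (intro infdist_le) (auto simp: R_def)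
    also have "\<dots> = norm (\<Psi> *v z - y)"
      by (simp add: dist_norm matrix_vector_mult_diff_distrib norm_minus_commute)
    finally have "g w \<le> 1 / 2 * (norm (\<Psi> *v z - y))\<^sup>2 + (\<Sum>i\<in>-S. \<rho> (z $ i))"
      by (simp add: g_def sums power_mono infdist_nonneg)
    moreover have "norm (\<Psi> *v (u + v) - y) = infdist (y - \<Psi> *v u) R"
      by (simp add: v dist_norm matrix_vector_right_distrib norm_minus_commute algebra_simps)
    then have "1 / 2 * (norm (\<Psi> *v (u + v) - y))\<^sup>2 + (\<Sum>i\<in>-S. \<rho> ((u + v) $ i)) = g u"
      using \<open>v \<in> V\<close> by (simp add: g_def V_def)
    ultimately show "1 / 2 * (norm (\<Psi> *v (u + v) - y))\<^sup>2 + (\<Sum>i\<in>-S. \<rho> ((u + v) $ i))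
        \<le> 1 / 2 * (norm (\<Psi> *v z - y))\<^sup>2 + (\<Sum>i\<in>-S. \<rho> (z $ i))"
      using u[OF \<open>w \<in> K\<close>] by linarith
  qed
qed

section \<open>Existence of minimizers for two classes of penalties\<close>

lemma objective_attains_min_of_coercive:
  assumes lsc: "lower_semicontinuous \<rho>" and nonneg: "\<And>t. 0 \<le> \<rho> t"
    and coercive: "filterlim \<rho> at_top at_infinity"
  shows "\<exists>x. \<forall>z. objective \<Psi> y \<rho> x \<le> objective \<Psi> y \<rho> z"
proof -
  obtain T where T: "\<And>t. T \<le> \<bar>t\<bar> \<Longrightarrow> objective \<Psi> y \<rho> 0 \<le> \<rho> t"
    using coercive unfolding filterlim_at_top eventually_at_infinity by fastforce
  obtain x where x: "\<And>z. (\<forall>i. \<bar>z $ i\<bar> \<le> max T 0) \<Longrightarrow> objective \<Psi> y \<rho> x \<le> objective \<Psi> y \<rho> z"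
    using least_squares_box_attains_min[OF lsc, of "max T 0" "{}" \<Psi> y]
    unfolding objective_def by auto
  have "objective \<Psi> y \<rho> x \<le> objective \<Psi> y \<rho> z" for z
  proof (cases "\<forall>i. \<bar>z $ i\<bar> \<le> max T 0")
    case True
    then show ?thesis
      by (rule x)
  next
    case False
    then obtain i where "T \<le> \<bar>z $ i\<bar>"
      by (meson max.cobounded1 linear order_trans)
    have "objective \<Psi> y \<rho> x \<le> objective \<Psi> y \<rho> 0"
      by (rule x) simp
    also have "\<dots> \<le> \<rho> (z $ i)"
      using T \<open>T \<le> \<bar>z $ i\<bar>\<close> .
    also have "\<dots> \<le> (\<Sum>i\<in>UNIV. \<rho> (z $ i))"
      using nonneg by (intro member_le_sum) auto
    also have "\<dots> \<le> objective \<Psi> y \<rho> z"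
      by (simp add: objective_def)
    finally show ?thesis .
  qed
  then show ?thesis
    by blast
qed

text \<open>The function \<open>J S\<close> replaces \<open>\<rho>\<close> by its maximum \<open>M\<close> on the coordinates in \<open>S\<close>. It is a majorant of
  the objective for every \<open>S\<close>, and agrees with it at \<open>z\<close> when \<open>S\<close> collects the coordinates of \<open>z\<close>
  beyond the threshold. That \<open>z\<close> satisfies the box constraint off this \<open>S\<close>, so the objective at \<open>z\<close>
  is bounded below by the restricted minimum for \<open>S\<close>. The minimizer itself may have small
  coordinates in its set; the majorant property covers that case.\<close>

lemma objective_attains_min_of_saturating:
  fixes \<Psi> :: "real ^ 'p ^ 'n"
  assumes lsc: "lower_semicontinuous \<rho>" and "0 \<le> T"
    and le: "\<And>t. \<rho> t \<le> M" and eq: "\<And>t. T < \<bar>t\<bar> \<Longrightarrow> \<rho> t = M"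
  shows "\<exists>x. \<forall>z. objective \<Psi> y \<rho> x \<le> objective \<Psi> y \<rho> z"
proof -
  define J where
    "J S x = 1 / 2 * (norm (\<Psi> *v x - y))\<^sup>2 + (\<Sum>i\<in>-S. \<rho> (x $ i)) + real (card S) * M"
    for S and x :: "real ^ 'p"
  have split: "(\<Sum>i\<in>UNIV. \<rho> (x $ i)) = (\<Sum>i\<in>-S. \<rho> (x $ i)) + (\<Sum>i\<in>S. \<rho> (x $ i))"
    for S and x :: "real ^ 'p"
    by (metis Compl_partition2 finite sum.union_disjoint Compl_disjoint2)
  have majorant: "objective \<Psi> y \<rho> x \<le> J S x" for S x
    using sum_bounded_above[of S "\<lambda>i. \<rho> (x $ i)" M] le
    by (simp add: objective_def J_def split[of x S])
  have "\<exists>x. \<forall>z. (\<forall>i\<in>-S. \<bar>z $ i\<bar> \<le> T) \<longrightarrow> J S x \<le> J S z" for S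
    using least_squares_box_attains_min[OF lsc \<open>0 \<le> T\<close>, of S \<Psi> y] by (simp add: J_def)
  then obtain X where X: "\<And>S z. (\<forall>i\<in>-S. \<bar>z $ i\<bar> \<le> T) \<Longrightarrow> J S (X S) \<le> J S z"
    by metis
  define best where "best = arg_min_on (\<lambda>S. J S (X S)) UNIV"
  have best: "J best (X best) \<le> J S (X S)" for S
    unfolding best_def by (intro arg_min_least) auto
  have "objective \<Psi> y \<rho> (X best) \<le> objective \<Psi> y \<rho> z" for z
  proof -
    define S where "S = {i. T < \<bar>z $ i\<bar>}"
    have "objective \<Psi> y \<rho> (X best) \<le> J best (X best)"
      by (rule majorant)
    also have "\<dots> \<le> J S (X S)"
      by (rule best)
    also have "\<dots> \<le> J S z"
      by (rule X) (auto simp: S_def)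
    also have "\<dots> = objective \<Psi> y \<rho> z"
    proof -
      have "(\<Sum>i\<in>S. \<rho> (z $ i)) = real (card S) * M"
        by (simp add: S_def eq)
      then show ?thesis
        by (simp add: objective_def J_def split[of z S])
    qed
    finally show ?thesis .
  qed
  then show ?thesis
    by blast
qed

section \<open>The five penalties\<close>

lemma lower_semicontinuous_l0_penalty:
  assumes "0 < lam"
  shows "lower_semicontinuous (l0_penalty lam)"
  unfolding lower_semicontinuous_def
proof
  fix c
  have "{t. c < l0_penalty lam t} = (if c < 0 then UNIV else if c < lam then - {0} else {})"
    using assms by (auto simp: l0_penalty_def)
  then show "open {t. c < l0_penalty lam t}"
    by auto
qed

lemma continuous_on_bridge_penalty:
  assumes "0 < \<tau>"
  shows "continuous_on UNIV (bridge_penalty lam \<tau>)"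
  unfolding bridge_penalty_def using assms
  by (intro continuous_intros continuous_on_powr') auto

lemma filterlim_bridge_penalty:
  assumes "0 < lam" and "0 < \<tau>"
  shows "filterlim (bridge_penalty lam \<tau>) at_top at_infinity"
proof -
  have "filterlim (\<lambda>t::real. norm t powr \<tau>) at_top at_infinity"
  proof (rule filterlim_compose[OF _ filterlim_norm_at_top])
    show "filterlim (\<lambda>s::real. s powr \<tau>) at_top at_top"
      using \<open>0 < \<tau>\<close> by real_asymp
  qed
  then show ?thesis
    unfolding bridge_penalty_def
    using filterlim_tendsto_pos_mult_at_top[OF tendsto_const \<open>0 < lam\<close>] by simp
qed

text \<open>The piecewise penalties are rewritten with \<open>min\<close> and \<open>max\<close>, which makes their continuity at the
  breakpoints evident.\<close>

lemma capped_l1_penalty_eq_min: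
  assumes "0 < lam"
  shows "capped_l1_penalty lam \<tau> t = lam * min \<bar>t\<bar> (lam * \<tau>)"
  using assms by (auto simp: capped_l1_penalty_def power2_eq_square)

text \<open>The linear piece runs until \<open>lam\<close> and the quadratic one takes over on \<open>[lam, lam * \<tau>]\<close>; the
  subtracted \<open>lam\<^sup>2\<close> is their common value at \<open>lam\<close>, where both clamped terms meet.\<close>

lemma scad_penalty_eq_clamp:
  assumes "0 < lam" and "1 < \<tau>"
  shows "scad_penalty lam \<tau> t = lam * min \<bar>t\<bar> lam - lam\<^sup>2 +
           (lam * \<tau> * max lam (min \<bar>t\<bar> (lam * \<tau>))
             - ((max lam (min \<bar>t\<bar> (lam * \<tau>)))\<^sup>2 + lam\<^sup>2) / 2) / (\<tau> - 1)"
proof -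
  have "lam < lam * \<tau>"
    using assms by simp
  consider "\<bar>t\<bar> \<le> lam" | "lam < \<bar>t\<bar>" "\<bar>t\<bar> \<le> lam * \<tau>" | "lam * \<tau> < \<bar>t\<bar>"
    by linarith
  then show ?thesis
  proof cases
    case 1
    then have "min \<bar>t\<bar> lam = \<bar>t\<bar>" and "max lam (min \<bar>t\<bar> (lam * \<tau>)) = lam"
      and "scad_penalty lam \<tau> t = lam * \<bar>t\<bar>"
      using \<open>lam < lam * \<tau>\<close> by (auto simp: scad_penalty_def)
    then show ?thesis
      using \<open>1 < \<tau>\<close> by (simp add: field_simps power2_eq_square)
  next
    case 2
    then show ?thesis
      using assms by (simp add: scad_penalty_def max_def min_def power2_eq_square)
  next
    case 3
    then have "min \<bar>t\<bar> lam = lam" and "max lam (min \<bar>t\<bar> (lam * \<tau>)) = lam * \<tau>"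
      and "scad_penalty lam \<tau> t = lam\<^sup>2 * (\<tau> + 1) / 2"
      using \<open>lam < lam * \<tau>\<close> by (auto simp: scad_penalty_def)
    then show ?thesis
      using \<open>1 < \<tau>\<close> by (simp add: field_simps power2_eq_square)
  qed
qed

lemma scad_penalty_le:
  assumes "0 < lam" and "1 < \<tau>"
  shows "scad_penalty lam \<tau> t \<le> lam\<^sup>2 * (\<tau> + 1) / 2"
proof -
  \<comment> \<open>The quadratic piece is a concave parabola with its vertex at \<open>\<bar>t\<bar> = lam * \<tau>\<close>.\<close>
  have "0 \<le> (\<bar>t\<bar> - lam * \<tau>)\<^sup>2"
    by simp
  then have "(lam * \<tau> * \<bar>t\<bar> - (t\<^sup>2 + lam\<^sup>2) / 2) / (\<tau> - 1) \<le> lam\<^sup>2 * (\<tau> + 1) / 2"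
    using assms by (simp add: divide_le_eq power2_diff) (simp add: field_simps power2_eq_square)
  moreover have "lam * \<bar>t\<bar> \<le> lam\<^sup>2 * (\<tau> + 1) / 2" if "\<bar>t\<bar> \<le> lam"
  proof -
    have "lam * \<bar>t\<bar> \<le> lam\<^sup>2 * 1"
      using that assms by (simp add: power2_eq_square)
    also have "\<dots> \<le> lam\<^sup>2 * ((\<tau> + 1) / 2)"
      using assms by (intro mult_left_mono) auto
    finally show ?thesis
      by simp
  qed
  ultimately show ?thesis
    by (simp add: scad_penalty_def)
qed

text \<open>Completing the square also exhibits the upper bound \<open>lam\<^sup>2 * \<tau> / 2\<close>.\<close>

lemma mcp_penalty_eq_min:
  assumes "0 < lam" and "0 < \<tau>"
  shows "mcp_penalty lam \<tau> t =
           lam\<^sup>2 * \<tau> / 2 - (\<tau> * lam - min \<bar>t\<bar> (\<tau> * lam))\<^sup>2 / (2 * \<tau>)"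
proof (cases "\<bar>t\<bar> < \<tau> * lam")
  case True
  then show ?thesis
    using assms by (simp add: mcp_penalty_def field_simps power2_eq_square)
next
  case False
  then show ?thesis
    by (simp add: mcp_penalty_def min_absorb2 mult.commute)
qed

theorem proposition2p1:
  fixes \<Psi> :: "real ^ 'p ^ 'n" and y :: "real ^ 'n"
    and lam :: real and \<rho> :: "real \<Rightarrow> real"
  assumes "\<And>i. norm (column i \<Psi>) = 1"
    and "lam > 0"
    and "nonconvex_penalty lam \<rho>"
  shows "\<exists>x. \<forall>z. objective \<Psi> y \<rho> x \<le> objective \<Psi> y \<rho> z"
  using assms(3)
proof cases
  case l0
  show ?thesis
    unfolding l0
    by (rule objective_attains_min_of_saturating[where T = 0 and M = lam])
       (use \<open>lam > 0\<close> in \<open>auto simp: lower_semicontinuous_l0_penalty l0_penalty_def\<close>)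
next
  case (bridge \<tau>)
  show ?thesis
    unfolding bridge(1)
  proof (rule objective_attains_min_of_coercive)
    show "lower_semicontinuous (bridge_penalty lam \<tau>)"
      using \<open>0 < \<tau>\<close> by (intro lower_semicontinuous_continuous continuous_on_bridge_penalty)
    show "0 \<le> bridge_penalty lam \<tau> t" for t
      using \<open>lam > 0\<close> by (simp add: bridge_penalty_def)
    show "filterlim (bridge_penalty lam \<tau>) at_top at_infinity"
      using \<open>lam > 0\<close> \<open>0 < \<tau>\<close> by (rule filterlim_bridge_penalty)
  qed
next
  case (capped_l1 \<tau>)
  have eq: "capped_l1_penalty lam \<tau> = (\<lambda>t. lam * min \<bar>t\<bar> (lam * \<tau>))"
    using \<open>lam > 0\<close> by (auto simp: capped_l1_penalty_eq_min)
  show ?thesis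
    unfolding capped_l1(1) eq
  proof (rule objective_attains_min_of_saturating[where T = "lam * \<tau>" and M = "lam * (lam * \<tau>)"])
    show "lower_semicontinuous (\<lambda>t. lam * min \<bar>t\<bar> (lam * \<tau>))"
      by (intro lower_semicontinuous_continuous continuous_intros)
  qed (use \<open>lam > 0\<close> \<open>\<tau> > 1 / 2\<close> in auto)
next
  case (scad \<tau>)
  then have "1 < \<tau>"
    by simp
  show ?thesis
    unfolding scad(1)
  proof (rule objective_attains_min_of_saturating)
    show "lower_semicontinuous (scad_penalty lam \<tau>)"
      unfolding scad_penalty_eq_clamp[OF \<open>lam > 0\<close> \<open>1 < \<tau>\<close>, abs_def]
      using \<open>1 < \<tau>\<close> by (intro lower_semicontinuous_continuous continuous_intros) auto
    show "scad_penalty lam \<tau> t \<le> lam\<^sup>2 * (\<tau> + 1) / 2" for t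
      using \<open>lam > 0\<close> \<open>1 < \<tau>\<close> by (rule scad_penalty_le)
    show "scad_penalty lam \<tau> t = lam\<^sup>2 * (\<tau> + 1) / 2" if "lam * \<tau> < \<bar>t\<bar>" for t
      using that by (simp add: scad_penalty_def)
    show "0 \<le> lam * \<tau>"
      using \<open>lam > 0\<close> \<open>1 < \<tau>\<close> by simp
  qed
next
  case (mcp \<tau>)
  then have "0 < \<tau>"
    by simp
  show ?thesis
    unfolding mcp(1)
  proof (rule objective_attains_min_of_saturating)
    show "lower_semicontinuous (mcp_penalty lam \<tau>)"
      unfolding mcp_penalty_eq_min[OF \<open>lam > 0\<close> \<open>0 < \<tau>\<close>, abs_def]
      using \<open>0 < \<tau>\<close> by (intro lower_semicontinuous_continuous continuous_intros) auto
    show "mcp_penalty lam \<tau> t \<le> lam\<^sup>2 * \<tau> / 2" for t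
      using \<open>lam > 0\<close> \<open>0 < \<tau>\<close> by (simp add: mcp_penalty_eq_min)
    show "mcp_penalty lam \<tau> t = lam\<^sup>2 * \<tau> / 2" if "\<tau> * lam < \<bar>t\<bar>" for t
      using that by (simp add: mcp_penalty_def)
    show "0 \<le> \<tau> * lam"
      using \<open>lam > 0\<close> \<open>0 < \<tau>\<close> by simp
  qed
qed

end
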